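(* Let $k\ge 1$ be an integer and let $p_r,p_a,p_h\in[0,1]$. Consider the homogeneous Independent Halting Cascade (IHC) branching process with parameters $(k,p_r,p_a,p_h)$ (defined in the context). Then each of the $k$ recommendation trials of the root results, independently of the other trials, in a neighbor that is activated and immediately halts with probability $$q = p_r\,p_a\,p_h .$$ Consequently, the number $H$ of halts in the first generation (i.e. the number of children of the root that halt) is distributed as $H\sim\mathrm{Bin}(k,q)$, and $$\mathbb{E}[H] = k\,p_r\,p_a\,p_h .$$ In particular, the direct-halting boundary, defined by the equation $k\,p_r\,p_a\,p_h=1$, is exactly the set of parameters with $\mathbb{E}[H]=1$, and it separates the region $\mathbb{E}[H]>1$ from the region $\mathbb{E}[H]<1$.
   Context: The homogeneous IHC branching process with parameters $k$ (number of recommendation trials per agent, the degree), $p_r$ (recommendation probability), $p_a$ (application probability) and $p_h$ (hiring probability) is the following random rooted tree whose non-root vertices carry decisions. The root agent does not apply; it performs $k$ independent recommendation trials, each succeeding with probability $p_r$, and each successful trial activates one neighbor, which becomes a child of the root. Thus the number of children of the root is distributed as $\mathrm{Bin}(k,p_r)$. Each activated (non-root) agent then behaves independently of everything else, as follows: with probability $p_a$ it applies, in which case it halts (is hired) with probability $p_h$, and with probability $1-p_h$ it fails, having no children in either case; with probability $1-p_a$ it does not apply and instead performs $k$ new independent recommendation trials, each succeeding with probability $p_r$ and each success activating one new child. The first generation is the set of children of the root. *)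

theory Defs
  imports "HOL-Probability.Probability"
begin

datatype decision = Hired | Failed | Recommending

definition decision_pmf :: "real \<Rightarrow> real \<Rightarrow> decision pmf" where
  "decision_pmf pa ph =
     bind_pmf (bernoulli_pmf pa) (\<lambda>applies.
       if applies
       then map_pmf (\<lambda>hired. if hired then Hired else Failed) (bernoulli_pmf ph)
       else return_pmf Recommending)"

text \<open>
  Potential agents are addressed in Ulam--Harris fashion: the root is the empty list, and
  \<open>v @ [i]\<close> is the agent that the \<open>i\<close>-th recommendation trial of \<open>v\<close> would activate. A sample
  point attaches to each address the outcome of the trial leading to it and the decision its
  agent takes if activated; these labels are drawn in advance for all addresses, and only those
  on the tree below matter. The label of the root is never used.
\<close>

type_synonym ihc_sample = "nat list \<Rightarrow> bool \<times> decision"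

definition ihc_measure :: "real \<Rightarrow> real \<Rightarrow> real \<Rightarrow> ihc_sample measure" where
  "ihc_measure pr pa ph =
     PiM UNIV (\<lambda>_. measure_pmf (pair_pmf (bernoulli_pmf pr) (decision_pmf pa ph)))"

definition trial_succeeds :: "ihc_sample \<Rightarrow> nat list \<Rightarrow> nat \<Rightarrow> bool" where
  "trial_succeeds \<omega> v i \<longleftrightarrow> fst (\<omega> (v @ [i]))"

definition recommends :: "ihc_sample \<Rightarrow> nat list \<Rightarrow> bool" where
  "recommends \<omega> v \<longleftrightarrow> v = [] \<or> snd (\<omega> v) = Recommending"

definition halts :: "ihc_sample \<Rightarrow> nat list \<Rightarrow> bool" where
  "halts \<omega> v \<longleftrightarrow> v \<noteq> [] \<and> snd (\<omega> v) = Hired"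

inductive_set ihc_tree :: "nat \<Rightarrow> ihc_sample \<Rightarrow> nat list set"
  for k :: nat and \<omega> :: ihc_sample where
  root: "[] \<in> ihc_tree k \<omega>"
| child: "\<lbrakk>v \<in> ihc_tree k \<omega>; recommends \<omega> v; i < k; trial_succeeds \<omega> v i\<rbrakk>
          \<Longrightarrow> v @ [i] \<in> ihc_tree k \<omega>"

definition children :: "nat \<Rightarrow> ihc_sample \<Rightarrow> nat list \<Rightarrow> nat list set" where
  "children k \<omega> v = {w \<in> ihc_tree k \<omega>. \<exists>i. w = v @ [i]}"

definition first_generation :: "nat \<Rightarrow> ihc_sample \<Rightarrow> nat list set" where
  "first_generation k \<omega> = children k \<omega> []"

definition first_gen_halts :: "nat \<Rightarrow> ihc_sample \<Rightarrow> nat" where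
  "first_gen_halts k \<omega> = card {v \<in> first_generation k \<omega>. halts \<omega> v}"

definition root_trial_halt :: "nat \<Rightarrow> real \<Rightarrow> real \<Rightarrow> real \<Rightarrow> nat \<Rightarrow> ihc_sample set" where
  "root_trial_halt k pr pa ph i =
     {\<omega> \<in> space (ihc_measure pr pa ph). [i] \<in> first_generation k \<omega> \<and> halts \<omega> [i]}"

definition mean_halts :: "nat \<Rightarrow> real \<Rightarrow> real \<Rightarrow> real \<Rightarrow> real" where
  "mean_halts k pr pa ph = (\<integral>\<omega>. real (first_gen_halts k \<omega>) \<partial>ihc_measure pr pa ph)"

definition ihc_params :: "(real \<times> real \<times> real) set" where
  "ihc_params = {0..1} \<times> {0..1} \<times> {0..1}"

definition direct_halting_boundary :: "nat \<Rightarrow> (real \<times> real \<times> real) set" where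
  "direct_halting_boundary k =
     {(pr, pa, ph). (pr, pa, ph) \<in> ihc_params \<and> real k * pr * pa * ph = 1}"

text \<open>
  \<open>B\<close> separates \<open>U\<close> from \<open>V\<close> inside \<open>X\<close>: removing \<open>B\<close> leaves exactly \<open>U\<close> and \<open>V\<close>, and these are
  topologically separated, so that a connected subset of \<open>X\<close> meeting both must meet \<open>B\<close>.
\<close>

definition separates_in :: "'a::topological_space set \<Rightarrow> 'a set \<Rightarrow> 'a set \<Rightarrow> 'a set \<Rightarrow> bool" where
  "separates_in X B U V \<longleftrightarrow>
     B \<subseteq> X \<and> U \<union> V = X - B \<and> separatedin (top_of_set (X - B)) U V"

end

theory Submission
  imports Defs
begin

text \<open>
  The \<open>i\<close>-th root trial halts exactly when the label of the address \<open>[i]\<close> is \<open>(True, Hired)\<close>.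
  Distinct coordinates of the product measure are independent, so \<open>H\<close> counts the successes of \<open>k\<close>
  independent trials of probability \<open>q\<close>. Its mean \<open>k p\<^sub>r p\<^sub>a p\<^sub>h\<close> is continuous in the parameters, hence
  the two open sides of its level set at \<open>1\<close> are separated.
\<close>

text \<open>Independence means that the joint law is the product of the marginals. Injectivity of
  \<open>f\<close> makes the joint law of the selected coordinates the reindexed product, whose
  factors are exactly the marginals. It is used with \<open>f i = [i]\<close>, which picks the
  depth-one addresses.\<close>

lemma indep_vars_PiM_reindex:
  assumes M: "\<And>i. i \<in> K \<Longrightarrow> prob_space (M i)"
    and f: "inj_on f I" "f \<in> I \<rightarrow> K"
  shows "prob_space.indep_vars (PiM K M) (\<lambda>i. M (f i)) (\<lambda>i \<omega>. \<omega> (f i)) I"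
proof -
  interpret prob_space "PiM K M"
    using M by (rule prob_space_PiM)
  \<comment> \<open>The criterion \<open>indep_vars_iff_distr_eq_PiM'\<close> assumes a nonempty
    index set, so the empty family is treated apart.\<close>
  show ?thesis
  proof (cases "I = {}")
    case True
    then show ?thesis
      by (simp add: indep_vars_def indep_sets_def)
  next
    case False
    have "distr (PiM K M) (\<Pi>\<^sub>M i\<in>I. M (f i)) (\<lambda>\<omega>. \<lambda>i\<in>I. \<omega> (f i)) = (\<Pi>\<^sub>M i\<in>I. M (f i))"
      using M f by (rule distr_PiM_reindex)
    also have "\<dots> = (\<Pi>\<^sub>M i\<in>I. distr (PiM K M) (M (f i)) (\<lambda>\<omega>. \<omega> (f i)))"
      using f M by (intro PiM_cong refl distr_PiM_component[symmetric]) auto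
    finally show ?thesis
      using f by (subst indep_vars_iff_distr_eq_PiM'[OF False]) (auto simp: Pi_iff)
  qed
qed

lemma (in prob_space) distr_bool_eq_bernoulli_pmf:
  assumes X: "random_variable (count_space UNIV) X"
    and p: "prob {\<omega> \<in> space M. X \<omega>} = p"
  shows "distr M (count_space UNIV) X = measure_pmf (bernoulli_pmf p)"
proof (rule measure_eqI_countable[where A = UNIV])
  fix b :: bool
  \<comment> \<open>These bounds hold because \<open>p\<close> is a probability; they make
    \<open>bernoulli_pmf p\<close> have mass exactly \<open>p\<close> at
    \<open>True\<close>.\<close>
  have p01: "0 \<le> p" "p \<le> 1"
    using p by auto
  have eq: "X -` {True} \<inter> space M = {\<omega> \<in> space M. X \<omega>}"
    and neq: "X -` {False} \<inter> space M = space M - {\<omega> \<in> space M. X \<omega>}"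
    by auto
  have "{\<omega> \<in> space M. X \<omega>} \<in> events"
    using measurable_sets[OF X, of "{True}"] by (simp add: eq)
  then have "prob (X -` {b} \<inter> space M) = pmf (bernoulli_pmf p) b"
    using p01 p by (cases b) (simp_all add: eq neq prob_compl)
  then show "emeasure (distr M (count_space UNIV) X) {b} = emeasure (bernoulli_pmf p) {b}"
    using X by (simp add: emeasure_distr emeasure_eq_measure emeasure_pmf_single)
qed simp_all

text \<open>The law of the count depends only on the joint law of the \<open>X i\<close>. This is a
  product of Bernoulli laws, so \<open>X\<close> may be exchanged for the coordinates under
  \<open>Pi_pmf\<close>, for which \<open>binomial_pmf_altdef'\<close> identifies the count as
  binomial.\<close>

lemma (in prob_space) distr_card_indep_vars_eq_binomial_pmf:
  assumes I: "finite I"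
    and X: "indep_vars (\<lambda>_. count_space UNIV) X I"
    and p: "p \<in> {0..1}" "\<And>i. i \<in> I \<Longrightarrow> prob {\<omega> \<in> space M. X i \<omega>} = p"
  shows "distr M (count_space UNIV) (\<lambda>\<omega>. card {i \<in> I. X i \<omega>}) = measure_pmf (binomial_pmf (card I) p)"
proof (cases "I = {}")
  case True
  then show ?thesis
    using p by (simp add: binomial_pmf_0 return_pmf.rep_eq distr_const)
next
  case False
  \<comment> \<open>\<open>?B\<close> is the reference model. Its sample points are total functions
    with default \<open>False\<close> outside \<open>I\<close>, and \<open>?c\<close> inspects them
    only on \<open>I\<close>.\<close>
  let ?N = "count_space UNIV :: nat measure" and ?P = "\<Pi>\<^sub>M i\<in>I. (count_space UNIV :: bool measure)"
    and ?c = "\<lambda>f. card {i \<in> I. f i}"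
    and ?B = "measure_pmf (Pi_pmf I False (\<lambda>_. bernoulli_pmf p))"
  have rv: "random_variable (count_space UNIV) (X i)" if "i \<in> I" for i
    using X that by (simp add: indep_vars_def)
  have c: "?c \<in> measurable ?P ?N"
  proof -
    have "?c = (\<lambda>f. \<Sum>i\<in>I. if f i then 1 else 0)"
      using I by (simp add: sum.If_cases Int_def)
    also have "\<dots> \<in> measurable ?P ?N"
      by measurable
    finally show ?thesis .
  qed
  \<comment> \<open>Points of \<open>?P\<close> are functions restricted to \<open>I\<close>; this
    identity lets the count pass between them and total functions.\<close>
  have c_restrict: "?c (\<lambda>i\<in>I. f i) = ?c f" for f
    by (rule arg_cong[of _ _ card]) auto
  have "distr M ?N (\<lambda>\<omega>. ?c (\<lambda>i. X i \<omega>)) = distr (distr M ?P (\<lambda>\<omega>. \<lambda>i\<in>I. X i \<omega>)) ?N ?c"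
    using rv by (subst distr_distr[OF c]) (simp_all add: comp_def c_restrict del: restrict_apply)
  also have "distr M ?P (\<lambda>\<omega>. \<lambda>i\<in>I. X i \<omega>) = (\<Pi>\<^sub>M i\<in>I. distr M (count_space UNIV) (X i))"
    using indep_vars_iff_distr_eq_PiM'[OF False rv] X by simp
  also have "\<dots> = (\<Pi>\<^sub>M i\<in>I. measure_pmf (bernoulli_pmf p))"
    by (intro PiM_cong refl distr_bool_eq_bernoulli_pmf rv p)
  \<comment> \<open>Each factor is reread as a marginal of \<open>?B\<close>, so that independence
    under \<open>?B\<close> turns the product back into a joint law.\<close>
  also have "\<dots> = (\<Pi>\<^sub>M i\<in>I. distr ?B (count_space UNIV) (\<lambda>f. f i))"
    using I by (intro PiM_cong refl) (simp flip: map_pmf_rep_eq add: Pi_pmf_component)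
  also have "\<dots> = distr ?B ?P (\<lambda>f. \<lambda>i\<in>I. f i)"
    using prob_space.indep_vars_iff_distr_eq_PiM'[OF prob_space_measure_pmf False,
        where M' = "\<lambda>_. count_space (UNIV :: bool set)" and X = "\<lambda>i f. f i"]
      indep_vars_Pi_pmf[OF I, of False "\<lambda>_. bernoulli_pmf p"] by simp
  also have "distr \<dots> ?N ?c = distr ?B ?N ?c"
    by (subst distr_distr[OF c]) (simp_all add: comp_def space_PiM c_restrict del: restrict_apply)
  also have "\<dots> = measure_pmf (binomial_pmf (card I) p)"
    using binomial_pmf_altdef'[OF I refl p(1), of False] by (simp add: map_pmf_rep_eq)
  finally show ?thesis .
qed

text \<open>Only the applying branch can end in \<open>Hired\<close>, and there the outcome
  \<open>True\<close> of the second coin is the only one that does.\<close>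

lemma pmf_decision_Hired:
  assumes "pa \<in> {0..1}" "ph \<in> {0..1}"
  shows "pmf (decision_pmf pa ph) Hired = pa * ph"
proof -
  have "(\<lambda>hired. if hired then Hired else Failed) -` {Hired} = {True}"
    by (auto split: if_splits)
  then have "pmf (map_pmf (\<lambda>hired. if hired then Hired else Failed) (bernoulli_pmf ph)) Hired = ph"
    using assms by (simp add: pmf_map measure_pmf_single)
  then show ?thesis
    using assms by (simp add: decision_pmf_def pmf_bind)
qed

lemma space_ihc_measure: "space (ihc_measure pr pa ph) = UNIV"
  by (simp add: ihc_measure_def space_PiM)

lemma prob_space_ihc_measure: "prob_space (ihc_measure pr pa ph)"
  unfolding ihc_measure_def by (intro prob_space_PiM prob_space_measure_pmf)

text \<open>A nonempty address enters the tree only by the rule \<open>child\<close>; for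
  \<open>[i]\<close> the parent is the root, which always recommends. So only the bound
  \<open>i < k\<close> and the success of the trial remain.\<close>

lemma mem_first_generation_iff:
  "v \<in> first_generation k \<omega> \<longleftrightarrow> (\<exists>i<k. v = [i] \<and> fst (\<omega> [i]))"
proof
  assume "v \<in> first_generation k \<omega>"
  then obtain i where v: "v = [i]" and "[i] \<in> ihc_tree k \<omega>"
    by (auto simp: first_generation_def children_def)
  from this(2) show "\<exists>i<k. v = [i] \<and> fst (\<omega> [i])"
    using v by cases (auto simp: trial_succeeds_def)
next
  assume "\<exists>i<k. v = [i] \<and> fst (\<omega> [i])"
  then show "v \<in> first_generation k \<omega>"
    using ihc_tree.child[OF ihc_tree.root, of \<omega> _ k]
    by (auto simp: first_generation_def children_def recommends_def trial_succeeds_def)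
qed

lemma root_trial_halt_eq:
  assumes "i < k"
  shows "root_trial_halt k pr pa ph i =
    {\<omega> \<in> space (ihc_measure pr pa ph). \<omega> [i] = (True, Hired)}"
  using assms by (auto simp: root_trial_halt_def mem_first_generation_iff halts_def prod_eq_iff)

text \<open>Passing from the vertices \<open>[i]\<close> to their indices turns a random set of
  children into a count over the fixed index set \<open>{..<k}\<close>, as the binomial lemma
  requires.\<close>

lemma first_gen_halts_eq_card: "first_gen_halts k \<omega> = card {i \<in> {..<k}. \<omega> [i] = (True, Hired)}"
proof -
  have "{v \<in> first_generation k \<omega>. halts \<omega> v} = (\<lambda>i. [i]) ` {i \<in> {..<k}. \<omega> [i] = (True, Hired)}"
    by (auto simp: mem_first_generation_iff halts_def prod_eq_iff)
  then show ?thesis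
    by (simp add: first_gen_halts_def card_image inj_on_def)
qed

text \<open>This form prepares linearity of expectation. It holds at every sample point because the
  space of \<open>ihc_measure\<close> is all of \<open>UNIV\<close>.\<close>

lemma first_gen_halts_eq_sum:
  "real (first_gen_halts k \<omega>) = (\<Sum>i<k. indicator (root_trial_halt k pr pa ph i) \<omega>)"
  by (simp add: first_gen_halts_eq_card root_trial_halt_eq space_ihc_measure indicator_def
      sum.If_cases Int_def)

lemma indep_vars_root_halts:
  "prob_space.indep_vars (ihc_measure pr pa ph) (\<lambda>_. count_space UNIV)
     (\<lambda>i \<omega>. \<omega> [i] = (True, Hired)) {..<k}"
proof -
  let ?L = "measure_pmf (pair_pmf (bernoulli_pmf pr) (decision_pmf pa ph))"
  interpret prob_space "ihc_measure pr pa ph"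
    by (rule prob_space_ihc_measure)
  have "indep_vars (\<lambda>_. ?L) (\<lambda>i \<omega>. \<omega> [i]) {..<k}"
    unfolding ihc_measure_def
    by (rule indep_vars_PiM_reindex) (auto simp: inj_on_def prob_space_measure_pmf)
  \<comment> \<open>Labels carry the discrete sigma-algebra, so testing for
    \<open>(True, Hired)\<close> is measurable and preserves independence.\<close>
  then show ?thesis
    by (rule indep_vars_compose2) simp
qed

lemma root_trial_halt_sets: "i < k \<Longrightarrow> root_trial_halt k pr pa ph i \<in> sets (ihc_measure pr pa ph)"
  unfolding root_trial_halt_eq ihc_measure_def by measurable

text \<open>The label at \<open>[i]\<close> has law \<open>?D\<close>, whose mass at
  \<open>(True, Hired)\<close> factors into \<open>pr\<close> for the trial and
  \<open>pa * ph\<close> for the decision.\<close>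

lemma measure_root_trial_halt:
  assumes "i < k" "pr \<in> {0..1}" "pa \<in> {0..1}" "ph \<in> {0..1}"
  shows "measure (ihc_measure pr pa ph) (root_trial_halt k pr pa ph i) = pr * pa * ph"
proof -
  let ?D = "pair_pmf (bernoulli_pmf pr) (decision_pmf pa ph)"
  let ?M = "PiM UNIV (\<lambda>_. measure_pmf ?D) :: ihc_sample measure"
  have "measure (ihc_measure pr pa ph) (root_trial_halt k pr pa ph i)
      = measure (distr ?M (measure_pmf ?D) (\<lambda>\<omega>. \<omega> [i])) {(True, Hired)}"
    using assms(1)
    by (subst measure_distr) (auto simp: root_trial_halt_eq ihc_measure_def intro!: arg_cong2[of _ _ _ _ measure])
  also have "distr ?M (measure_pmf ?D) (\<lambda>\<omega>. \<omega> [i]) = measure_pmf ?D"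
    by (rule distr_PiM_component) (simp_all add: prob_space_measure_pmf)
  finally show ?thesis
    using assms by (simp add: measure_pmf_single pmf_pair pmf_decision_Hired)
qed

lemma
  assumes "pr \<in> {0..1}" "pa \<in> {0..1}" "ph \<in> {0..1}"
  shows integrable_first_gen_halts:
      "integrable (ihc_measure pr pa ph) (\<lambda>\<omega>. real (first_gen_halts k \<omega>))"
    and mean_halts_eq: "mean_halts k pr pa ph = real k * pr * pa * ph"
proof -
  interpret prob_space "ihc_measure pr pa ph"
    by (rule prob_space_ihc_measure)
  have int: "integrable (ihc_measure pr pa ph) (indicator (root_trial_halt k pr pa ph i) :: _ \<Rightarrow> real)"
    if "i < k" for i
    using root_trial_halt_sets[OF that] by (simp add: emeasure_eq_measure)
  then show "integrable (ihc_measure pr pa ph) (\<lambda>\<omega>. real (first_gen_halts k \<omega>))"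
    unfolding first_gen_halts_eq_sum[of k _ pr pa ph] by (intro Bochner_Integration.integrable_sum) simp
  show "mean_halts k pr pa ph = real k * pr * pa * ph"
    unfolding mean_halts_def first_gen_halts_eq_sum[of k _ pr pa ph]
    using int assms by (subst Bochner_Integration.integral_sum)
      (simp_all add: measure_root_trial_halt space_ihc_measure)
qed

text \<open>The two sides are preimages of open rays, hence relatively open once the level set is
  removed; disjoint open sets are separated.\<close>

lemma separates_in_level_set:
  fixes f :: "'a::topological_space \<Rightarrow> real"
  assumes "continuous_on X f"
  shows "separates_in X {x \<in> X. f x = c} {x \<in> X. f x > c} {x \<in> X. f x < c}"
proof -
  let ?Y = "X - {x \<in> X. f x = c}"
  have cont: "continuous_on ?Y f"
    using assms by (rule continuous_on_subset) auto
  have "{x \<in> X. f x > c} = ?Y \<inter> f -` {c<..}" "{x \<in> X. f x < c} = ?Y \<inter> f -` {..<c}"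
    by auto
  then have "openin (top_of_set ?Y) {x \<in> X. f x > c}" "openin (top_of_set ?Y) {x \<in> X. f x < c}"
    using cont by (simp_all add: continuous_openin_preimage_gen)
  then have "separatedin (top_of_set ?Y) {x \<in> X. f x > c} {x \<in> X. f x < c}"
    by (subst separatedin_open_sets) (auto simp: disjnt_def)
  then show ?thesis
    by (auto simp: separates_in_def)
qed

theorem proposition1:
  fixes k :: nat and pr pa ph :: real
  assumes "k \<ge> 1" and "pr \<in> {0..1}" and "pa \<in> {0..1}" and "ph \<in> {0..1}"
  shows "(\<forall>i<k. measure (ihc_measure pr pa ph) (root_trial_halt k pr pa ph i) = pr * pa * ph)
       \<and> prob_space.indep_events (ihc_measure pr pa ph) (root_trial_halt k pr pa ph) {..<k}
       \<and> first_gen_halts k \<in> measurable (ihc_measure pr pa ph) (count_space UNIV)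
       \<and> distr (ihc_measure pr pa ph) (count_space UNIV) (first_gen_halts k)
           = measure_pmf (binomial_pmf k (pr * pa * ph))
       \<and> integrable (ihc_measure pr pa ph) (\<lambda>\<omega>. real (first_gen_halts k \<omega>))
       \<and> mean_halts k pr pa ph = real k * pr * pa * ph
       \<and> direct_halting_boundary k
           = {(r, a, h). (r, a, h) \<in> ihc_params \<and> mean_halts k r a h = 1}
       \<and> separates_in ihc_params (direct_halting_boundary k)
           {(r, a, h). (r, a, h) \<in> ihc_params \<and> mean_halts k r a h > 1}
           {(r, a, h). (r, a, h) \<in> ihc_params \<and> mean_halts k r a h < 1}"
proof (intro conjI)
  let ?M = "ihc_measure pr pa ph" and ?X = "\<lambda>i (\<omega> :: ihc_sample). \<omega> [i] = (True, Hired)"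
  interpret prob_space ?M
    by (rule prob_space_ihc_measure)
  have indep: "indep_vars (\<lambda>_. count_space UNIV) ?X {..<k}"
    by (rule indep_vars_root_halts)
  have q: "pr * pa * ph \<in> {0..1}"
    using assms by (auto intro!: mult_nonneg_nonneg mult_le_one)
  show prob: "\<forall>i<k. measure ?M (root_trial_halt k pr pa ph i) = pr * pa * ph"
    using assms by (simp add: measure_root_trial_halt)
  have "indep_events (\<lambda>i. {\<omega> \<in> space ?M. ?X i \<omega>}) {..<k}"
    using indep by (rule indep_eventsI_indep_vars) simp
  \<comment> \<open>\<open>root_trial_halt_eq\<close> holds only for \<open>i < k\<close>, so the
    events are exchanged by a congruence over the index set.\<close>
  then show "indep_events (root_trial_halt k pr pa ph) {..<k}"
    unfolding indep_events_def_alt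
    by (rule indep_sets_cong[THEN iffD1, rotated 2]) (simp_all add: root_trial_halt_eq)
  show int: "integrable ?M (\<lambda>\<omega>. real (first_gen_halts k \<omega>))"
    using assms by (intro integrable_first_gen_halts)
  \<comment> \<open>Integrability gives measurability of the real-valued count; the floor brings it
    back to the naturals.\<close>
  have "(\<lambda>\<omega>. nat \<lfloor>real (first_gen_halts k \<omega>)\<rfloor>) \<in> measurable ?M (count_space UNIV)"
    using borel_measurable_integrable[OF int] by measurable
  then show "first_gen_halts k \<in> measurable ?M (count_space UNIV)"
    by simp
  show "distr ?M (count_space UNIV) (first_gen_halts k) = measure_pmf (binomial_pmf k (pr * pa * ph))"
    using distr_card_indep_vars_eq_binomial_pmf[OF _ indep q] prob
    by (simp add: root_trial_halt_eq first_gen_halts_eq_card[abs_def])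
  show "mean_halts k pr pa ph = real k * pr * pa * ph"
    using assms by (intro mean_halts_eq)
next
  \<comment> \<open>On the parameter cube the mean agrees with the polynomial \<open>?m\<close>.
    Continuity is evident for \<open>?m\<close>, so the level set lemma is applied to it and the
    three sets are then rewritten in terms of \<open>mean_halts\<close>.\<close>
  let ?m = "\<lambda>(r, a, h). real k * r * a * h"
  have mean: "mean_halts k r a h = real k * r * a * h" if "(r, a, h) \<in> ihc_params" for r a h
    using that by (intro mean_halts_eq) (auto simp: ihc_params_def)
  then show boundary: "direct_halting_boundary k
      = {(r, a, h). (r, a, h) \<in> ihc_params \<and> mean_halts k r a h = 1}"
    by (auto simp: direct_halting_boundary_def)
  have "separates_in ihc_params {x \<in> ihc_params. ?m x = 1} {x \<in> ihc_params. ?m x > 1}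
      {x \<in> ihc_params. ?m x < 1}"
    by (intro separates_in_level_set) (auto simp: case_prod_unfold intro!: continuous_intros)
  also have "{x \<in> ihc_params. ?m x = 1} = direct_halting_boundary k"
    by (auto simp: direct_halting_boundary_def)
  also have "{x \<in> ihc_params. ?m x > 1} = {(r, a, h). (r, a, h) \<in> ihc_params \<and> mean_halts k r a h > 1}"
    using mean by auto
  also have "{x \<in> ihc_params. ?m x < 1} = {(r, a, h). (r, a, h) \<in> ihc_params \<and> mean_halts k r a h < 1}"
    using mean by auto
  finally show "separates_in ihc_params (direct_halting_boundary k)
      {(r, a, h). (r, a, h) \<in> ihc_params \<and> mean_halts k r a h > 1}
      {(r, a, h). (r, a, h) \<in> ihc_params \<and> mean_halts k r a h < 1}" .
qed

end
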